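(* Let $1\le d<N$. Draw a random subspace $P$ uniformly with respect to the Haar measure from $G(d,N)$, and let $x\in\mathbb{R}^N$ be a randomly chosen vector. Then, with probability $1$, the quantities $$\|Pe_i\|_2^2\ (i\in\{1,\dots,N-1\}),\qquad \|P(e_j+e_k)\|_2^2\ (j\in\{1,\dots,d\},\ k\in\{j+1,\dots,N\}),\qquad \|Px\|_2^2$$ uniquely determine $P$, i.e. $P$ is the only $H\in G(d,N)$ for which all of these quantities coincide with the corresponding quantities $\|He_i\|_2^2$, $\|H(e_j+e_k)\|_2^2$, $\|Hx\|_2^2$.
   Context: $G(d,N)$ denotes the Grassmannian of $d$-dimensional linear subspaces of $\mathbb{R}^N$; for a subspace $H$, $Hy$ denotes the orthogonal projection of $y$ onto $H$. $e_1,\dots,e_N$ are the canonical unit vectors of $\mathbb{R}^N$. The random vector $x$ is understood to be drawn independently of $P$ from a probability distribution absolutely continuous with respect to Lebesgue measure. *)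

theory Defs
  imports "HOL-Probability.Probability"
begin

text \<open>Subspaces of R^N are represented by their orthogonal projection matrices:
  H in G(d,N) corresponds to the symmetric idempotent N x N matrix of rank d,
  and H y is the matrix-vector product.\<close>

definition grassmannian :: "nat \<Rightarrow> (real^'n^'n) set" where
  "grassmannian d = {P. transpose P = P \<and> P ** P = P \<and> rank P = d}"

text \<open>Haar (uniform) probability measure on G(d,N): a Borel probability measure on
  N x N matrices, concentrated on G(d,N), invariant under the action
  H \<mapsto> Q H of the orthogonal group (on projections: P \<mapsto> Q P Q^T).
  The invariant probability measure is unique, so this characterises Haar measure.\<close>

definition haar_grassmannian :: "nat \<Rightarrow> (real^'n^'n) measure \<Rightarrow> bool" where
  "haar_grassmannian d M \<longleftrightarrow>
     sets M = sets borel \<and> prob_space M \<and> emeasure M (grassmannian d) = 1 \<and>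
     (\<forall>Q::real^'n^'n. orthogonal_matrix Q \<longrightarrow>
        distr M M (\<lambda>P. Q ** P ** transpose Q) = M)"

text \<open>Canonical basis e_1,...,e_N: the index type is linearly ordered, and the
  position of index i is card {j. j < i} + 1.\<close>

definition idx_pos :: "'n::{finite,linorder} \<Rightarrow> nat" where
  "idx_pos i = card {j. j < i} + 1"

definition unit_vec :: "'n::finite \<Rightarrow> real^'n" where
  "unit_vec i = axis i 1"

definition determined_by_measurements ::
  "nat \<Rightarrow> real^('n::{finite,linorder})^('n::{finite,linorder}) \<Rightarrow> real^('n::{finite,linorder}) \<Rightarrow> bool" where
  "determined_by_measurements d P x \<longleftrightarrow>
     (\<forall>H \<in> grassmannian d.
        ((\<forall>i. idx_pos i \<le> CARD('n) - 1 \<longrightarrow>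
              norm (H *v unit_vec i)^2 = norm (P *v unit_vec i)^2) \<and>
         (\<forall>j k. idx_pos j \<le> d \<and> j < k \<longrightarrow>
              norm (H *v (unit_vec j + unit_vec k))^2 = norm (P *v (unit_vec j + unit_vec k))^2) \<and>
         norm (H *v x)^2 = norm (P *v x)^2) \<longrightarrow> H = P)"

end

theory Submission
  imports Defs "HOL-Computational_Algebra.Polynomial"
begin

text \<open>The measurements at the unit vectors give the diagonal of the projection matrix P except
  for its last entry, which the trace d supplies; the measurements at the sums e_j + e_k then give
  all entries of the first d rows, i.e. the first d columns of P. If P is injective on
  span {e_1, ..., e_d}, these columns span the range of P, and an orthogonal projection is
  determined by its range.

  Injectivity fails only on a Haar-null set. Let j be the first index for which the kernel of P
  meets span {e_i : i \<le> j}. Conjugating P by the reflection that swaps e_j with a unit vector a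
  supported on {i \<ge> j} preserves this property only if a is orthogonal to a fixed nonzero vector
  u of the range of P supported on {i \<ge> j}, which exists by counting dimensions. For a running
  through directions of the moment curve, u \<bullet> a is a nonzero polynomial, so a fixed P lies in at
  most N of the infinitely many conjugated events; by invariance of the Haar measure they all have
  the same probability, which must therefore be 0.\<close>

subsection \<open>Positions of indices\<close>

lemma idx_pos_less_mono:
  fixes i k :: "'n::{finite,linorder}"
  assumes "i < k"
  shows "idx_pos i < idx_pos k"
  unfolding idx_pos_def using assms by (auto intro!: psubset_card_mono)

lemma idx_pos_le_mono:
  fixes i k :: "'n::{finite,linorder}"
  assumes "i \<le> k"
  shows "idx_pos i \<le> idx_pos k"
  using assms by (metis idx_pos_less_mono le_less less_imp_le order_refl)

lemma inj_idx_pos: "inj (idx_pos :: 'n::{finite,linorder} \<Rightarrow> nat)"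
  by (rule injI) (metis idx_pos_less_mono less_irrefl linorder_neq_iff)

lemma range_idx_pos: "range (idx_pos :: 'n::{finite,linorder} \<Rightarrow> nat) = {1..CARD('n)}"
proof -
  have "card {j. j < i} < CARD('n)" for i :: 'n
    by (rule psubset_card_mono) auto
  then have "range (idx_pos :: 'n \<Rightarrow> nat) \<subseteq> {1..CARD('n)}"
    by (auto simp: idx_pos_def Suc_le_eq)
  moreover have "card (range (idx_pos :: 'n \<Rightarrow> nat)) = card {1..CARD('n)}"
    using card_image[OF inj_idx_pos] by simp
  ultimately show ?thesis
    by (simp add: card_subset_eq)
qed

lemma idx_pos_le_card: "idx_pos (i::'n::{finite,linorder}) \<le> CARD('n)"
  using range_idx_pos[where 'n='n] by (metis atLeastAtMost_iff rangeI)

lemma card_idx_pos_le: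
  assumes "d \<le> CARD('n::{finite,linorder})"
  shows "card {i::'n. idx_pos i \<le> d} = d"
proof -
  have "{i::'n. idx_pos i \<le> d} = idx_pos -` {1..d}"
    using range_idx_pos[where 'n='n] by auto
  also have "card \<dots> = d"
    using assms range_idx_pos[where 'n='n] by (subst card_vimage_inj[OF inj_idx_pos]) auto
  finally show ?thesis .
qed

subsection \<open>Coordinate subspaces\<close>

definition coord_subspace :: "'n set \<Rightarrow> (real^'n) set" where
  "coord_subspace I = {c. \<forall>i. i \<notin> I \<longrightarrow> c$i = 0}"

definition coord_restrict :: "'n set \<Rightarrow> real^'n \<Rightarrow> real^'n" where
  "coord_restrict I x = (\<chi> i. if i \<in> I then x$i else 0)"

lemma subspace_coord_subspace: "subspace (coord_subspace I)"
  by (auto simp: subspace_def coord_subspace_def)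

lemma dim_coord_subspace: "dim (coord_subspace (I :: 'n::finite set)) = card I"
  using dim_substandard_cart[where 'a=real and 'n='n and d=I]
  by (simp add: coord_subspace_def dim_vec_eq)

lemma linear_coord_restrict: "linear (coord_restrict I)"
  by (rule linearI) (auto simp: coord_restrict_def vec_eq_iff)

lemma coord_restrict_in_coord_subspace: "coord_restrict I x \<in> coord_subspace I"
  by (simp add: coord_restrict_def coord_subspace_def)

lemma inner_eq_0_if_disjoint_support:
  fixes x y :: "real^'n"
  assumes "\<And>i. x$i = 0 \<or> y$i = 0"
  shows "x \<bullet> y = 0"
  unfolding inner_vec_def using assms by (intro sum.neutral) auto

lemma inner_coord_restrict:
  assumes "u \<in> coord_subspace I"
  shows "u \<bullet> coord_restrict I x = u \<bullet> x"
  using assms by (auto simp: inner_vec_def coord_restrict_def coord_subspace_def intro!: sum.cong)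

lemma exists_nonzero_vanishing_on:
  fixes V :: "(real^'n) set"
  assumes "subspace V" and "card I < dim V"
  obtains u where "u \<in> V" "u \<noteq> 0" "u \<in> coord_subspace (- I)"
proof -
  have "\<not> inj_on (coord_restrict I) V"
  proof
    assume "inj_on (coord_restrict I) V"
    moreover have "span V = V"
      using assms(1) by (simp add: span_eq_iff)
    ultimately have "dim V = dim (coord_restrict I ` V)"
      using dim_image_eq[OF linear_coord_restrict, of I V] by metis
    also have "\<dots> \<le> dim (coord_subspace I)"
      by (rule dim_subset) (auto intro: coord_restrict_in_coord_subspace)
    finally show False
      using assms(2) by (simp add: dim_coord_subspace)
  qed
  then obtain u where u: "u \<in> V" "u \<noteq> 0" "coord_restrict I u = 0"
    using linear_inj_on_iff_eq_0[OF linear_coord_restrict assms(1)] by blast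
  have "u$i = 0" if "i \<in> I" for i
  proof -
    have "(coord_restrict I u)$i = 0"
      using u(3) by simp
    then show ?thesis
      using that by (simp add: coord_restrict_def)
  qed
  then show ?thesis
    using u by (intro that) (auto simp: coord_subspace_def)
qed

lemma not_inj_on_coord_subspace_iff:
  fixes X :: "real^'n^'n"
  shows "\<not> inj_on ((*v) X) (coord_subspace I) \<longleftrightarrow>
    (\<exists>c \<in> coord_subspace I. c \<noteq> 0 \<and> X *v c = 0)"
  using linear_inj_on_iff_eq_0[OF matrix_vector_mul_linear subspace_coord_subspace] by blast

lemma not_inj_on_coord_subspace_initial:
  fixes X :: "real^('n::{finite,linorder})^('n::{finite,linorder})"
  assumes "\<not> inj_on ((*v) X) (coord_subspace I)"
  obtains k where "k \<in> I" "\<not> inj_on ((*v) X) (coord_subspace {i. i \<le> k})"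
proof -
  obtain c where c: "c \<in> coord_subspace I" "c \<noteq> 0" "X *v c = 0"
    using assms not_inj_on_coord_subspace_iff by blast
  define k where "k = Max {i. c$i \<noteq> 0}"
  have "{i. c$i \<noteq> 0} \<noteq> {}"
    using c(2) by (auto simp: vec_eq_iff)
  then have "c$k \<noteq> 0"
    using Max_in[of "{i. c$i \<noteq> 0}"] by (simp add: k_def)
  then have "k \<in> I"
    using c(1) by (auto simp: coord_subspace_def)
  moreover have "c \<in> coord_subspace {i. i \<le> k}"
    using Max_ge[of "{i. c$i \<noteq> 0}"] unfolding coord_subspace_def k_def by fastforce
  then have "\<not> inj_on ((*v) X) (coord_subspace {i. i \<le> k})"
    using c(2,3) not_inj_on_coord_subspace_iff by blast
  ultimately show ?thesis
    by (rule that)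
qed

lemma matrix_vector_mult_eq_on_coord_subspace:
  fixes H P :: "real^'n^'m"
  assumes "\<And>a b. b \<in> I \<Longrightarrow> H$a$b = P$a$b" and "c \<in> coord_subspace I"
  shows "H *v c = P *v c"
  using assms unfolding coord_subspace_def
  by (auto simp: vec_eq_iff matrix_vector_mult_def intro!: sum.cong) metis

subsection \<open>Orthogonal projections\<close>

definition orth_proj :: "real^'n^'n \<Rightarrow> bool" where
  "orth_proj X \<longleftrightarrow> transpose X = X \<and> X ** X = X"

lemma grassmannian_iff: "P \<in> grassmannian d \<longleftrightarrow> orth_proj P \<and> rank P = d"
  by (auto simp: grassmannian_def orth_proj_def)

lemma orth_proj_entry_sym: "orth_proj X \<Longrightarrow> X$k$j = X$j$k"
  unfolding orth_proj_def by (metis transpose_def vec_lambda_beta)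

lemma orth_proj_idem_apply: "orth_proj X \<Longrightarrow> X *v (X *v x) = X *v x"
  by (simp add: orth_proj_def matrix_vector_mul_assoc)

lemma orth_proj_inner_commute: "orth_proj X \<Longrightarrow> (X *v x) \<bullet> y = x \<bullet> (X *v y)"
  unfolding orth_proj_def by (metis dot_lmul_matrix transpose_matrix_vector)

lemma norm_orth_proj_apply_sq: "orth_proj X \<Longrightarrow> norm (X *v v)^2 = v \<bullet> (X *v v)"
  by (metis power2_norm_eq_inner orth_proj_idem_apply orth_proj_inner_commute)

lemma matrix_vector_mult_axis_component: "(X *v axis k 1)$j = (X :: real^'n^'m)$j$k"
  by (simp add: matrix_vector_mult_basis column_def)

lemma norm_orth_proj_axis_sq: "orth_proj X \<Longrightarrow> norm (X *v axis i 1)^2 = X$i$i"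
  by (simp add: norm_orth_proj_apply_sq inner_axis' matrix_vector_mult_axis_component)

lemma norm_orth_proj_axis_add_sq:
  assumes "orth_proj X"
  shows "norm (X *v (axis j 1 + axis k 1))^2 = X$j$j + X$k$k + 2 * X$j$k"
  unfolding norm_orth_proj_apply_sq[OF assms] using orth_proj_entry_sym[OF assms, of k j]
  by (simp add: matrix_vector_right_distrib inner_add_left
      inner_add_right inner_axis' matrix_vector_mult_axis_component)

lemma trace_orth_proj:
  fixes X :: "real^'n^'n"
  assumes X: "orth_proj X"
  shows "trace X = real (rank X)"
proof -
  obtain B where BX: "B \<subseteq> range ((*v) X)" and orth: "pairwise orthogonal B"
    and unit: "\<And>b. b \<in> B \<Longrightarrow> norm b = 1" and indep: "independent B"
    and card_B: "card B = dim (range ((*v) X))" and span_B: "span B = range ((*v) X)"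
    by (rule orthonormal_basis_subspace[of "range ((*v) X)"]) (auto simp: linear_subspace_image)
  have fin: "finite B"
    using indep by (simp add: independent_bound)
  have inner_b: "(X *v axis i 1) \<bullet> b = b$i" if "b \<in> B" for b i
  proof -
    have "X *v b = b"
      using that BX orth_proj_idem_apply[OF X] by auto
    then show ?thesis
      by (simp add: orth_proj_inner_commute[OF X] inner_axis')
  qed
  have diag: "X$i$i = (\<Sum>b\<in>B. b$i * b$i)" for i
  proof -
    have "X *v axis i 1 = (\<Sum>b\<in>B. ((X *v axis i 1) \<bullet> b) *\<^sub>R b)"
      using orthonormal_basis_expand[OF orth unit _ fin] span_B by auto
    then have "X$i$i = (\<Sum>b\<in>B. ((X *v axis i 1) \<bullet> b) *\<^sub>R b)$i"
      by (simp only: matrix_vector_mult_axis_component[symmetric])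
    also have "\<dots> = (\<Sum>b\<in>B. b$i * b$i)"
      by (simp add: sum_component inner_b cong: sum.cong)
    finally show ?thesis .
  qed
  have "trace X = (\<Sum>b\<in>B. \<Sum>i\<in>UNIV. b$i * b$i)"
    by (simp add: trace_def diag sum.swap[of _ UNIV])
  also have "\<dots> = (\<Sum>b\<in>B. 1)"
    using unit by (intro sum.cong) (auto simp: norm_eq_1 inner_vec_def)
  also have "\<dots> = real (rank X)"
    by (simp add: card_B rank_dim_range)
  finally show ?thesis .
qed

lemma orth_proj_diag_eq:
  fixes P H :: "real^'n^'n"
  assumes P: "orth_proj P" and H: "orth_proj H" and rank: "rank H = rank P"
    and diag: "\<And>k. k \<noteq> i \<Longrightarrow> H$k$k = P$k$k"
  shows "H$i$i = P$i$i"
proof -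
  have "H$i$i + (\<Sum>k\<in>UNIV - {i}. H$k$k) = P$i$i + (\<Sum>k\<in>UNIV - {i}. P$k$k)"
    using trace_orth_proj[OF P] trace_orth_proj[OF H] rank
    by (simp add: trace_def sum.remove[of UNIV i])
  moreover have "(\<Sum>k\<in>UNIV - {i}. H$k$k) = (\<Sum>k\<in>UNIV - {i}. P$k$k)"
    using diag by (intro sum.cong) auto
  ultimately show ?thesis
    by simp
qed

lemma orth_proj_eq_if_range_eq:
  fixes P H :: "real^'n^'n"
  assumes P: "orth_proj P" and H: "orth_proj H" and range: "range ((*v) P) = range ((*v) H)"
  shows "H = P"
proof -
  have fixes_range: "Y ** X = X" if Y: "orth_proj Y" and sub: "range ((*v) X) \<subseteq> range ((*v) Y)"
    for X Y :: "real^'n^'n"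
  proof (subst matrix_eq, intro allI)
    fix x
    have "X *v x \<in> range ((*v) Y)"
      using sub by (rule subsetD) (rule rangeI)
    then obtain w where "X *v x = Y *v w"
      by (rule rangeE)
    then show "(Y ** X) *v x = X *v x"
      by (simp add: matrix_vector_mul_assoc[symmetric] orth_proj_idem_apply[OF Y])
  qed
  have "H = transpose (P ** H)"
    using fixes_range[OF P] range H unfolding orth_proj_def by simp
  also have "\<dots> = H ** P"
    using P H unfolding orth_proj_def by (simp add: matrix_transpose_mul)
  also have "\<dots> = P"
    using fixes_range[OF H] range by simp
  finally show ?thesis .
qed

lemma orth_proj_eq_if_agree_on_subspace:
  fixes P H :: "real^'n^'n"
  assumes P: "orth_proj P" and H: "orth_proj H" and rank: "rank H = rank P"
    and V: "subspace V" "dim V = rank P" and inj: "inj_on ((*v) P) V"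
    and agree: "\<And>v. v \<in> V \<Longrightarrow> H *v v = P *v v"
  shows "H = P"
proof -
  have "span V = V"
    using V(1) by (simp add: span_eq_iff)
  then have dim_image: "dim ((*v) P ` V) = rank P"
    using dim_image_eq[OF matrix_vector_mul_linear, of P V] inj V(2) by metis
  have image_eq_range: "(*v) P ` V = range ((*v) X)"
    if "(*v) P ` V \<subseteq> range ((*v) X)" "rank X = rank P" for X :: "real^'n^'n"
  proof (rule subspace_dim_equal)
    show "subspace ((*v) P ` V)"
      using V by (simp add: linear_subspace_image)
  qed (use that dim_image in \<open>auto simp: linear_subspace_image rank_dim_range\<close>)
  have "range ((*v) P) = (*v) P ` V"
    by (rule image_eq_range[symmetric]) auto
  also have "\<dots> = range ((*v) H)"
  proof (rule image_eq_range)
    show "(*v) P ` V \<subseteq> range ((*v) H)"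
      using agree by (metis image_subsetI rangeI)
  qed (rule rank)
  finally show ?thesis
    by (rule orth_proj_eq_if_range_eq[OF P H])
qed

subsection \<open>Recovering a projection from the measurements\<close>

lemma first_rows_eq_if_measurements_agree:
  fixes P H :: "real^('n::{finite,linorder})^('n::{finite,linorder})"
  assumes PG: "P \<in> grassmannian d" and HG: "H \<in> grassmannian d"
    and diag_meas: "\<forall>i. idx_pos i \<le> CARD('n) - 1 \<longrightarrow>
      norm (H *v unit_vec i)^2 = norm (P *v unit_vec i)^2"
    and pair_meas: "\<forall>j k. idx_pos j \<le> d \<and> j < k \<longrightarrow>
      norm (H *v (unit_vec j + unit_vec k))^2 = norm (P *v (unit_vec j + unit_vec k))^2"
    and j: "idx_pos j \<le> d"
  shows "H$j$k = P$j$k"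
proof -
  have P: "orth_proj P" "rank P = d" and H: "orth_proj H" "rank H = d"
    using PG HG by (auto simp: grassmannian_iff)
  have diag_known: "H$i$i = P$i$i" if "idx_pos i \<le> CARD('n) - 1" for i
    using diag_meas that norm_orth_proj_axis_sq[OF P(1), of i] norm_orth_proj_axis_sq[OF H(1), of i]
    by (simp add: unit_vec_def)
  have diag: "H$i$i = P$i$i" for i
  proof (cases "idx_pos i \<le> CARD('n) - 1")
    case False
    have "idx_pos k \<le> CARD('n) - 1" if "k \<noteq> i" for k
      using False that idx_pos_le_card[of k] idx_pos_le_card[of i] injD[OF inj_idx_pos, of k i]
      by (cases "idx_pos k = idx_pos i") auto
    then show ?thesis
      using orth_proj_diag_eq[OF P(1) H(1)] P(2) H(2) diag_known by auto
  qed (rule diag_known)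
  have upper: "H$j$k = P$j$k" if "idx_pos j \<le> d" "j < k" for j k
    using pair_meas that diag[of j] diag[of k]
      norm_orth_proj_axis_add_sq[OF P(1), of j k] norm_orth_proj_axis_add_sq[OF H(1), of j k]
    by (simp add: unit_vec_def)
  show ?thesis
  proof (cases j k rule: linorder_cases)
    case greater
    then have "H$k$j = P$k$j"
      using upper j idx_pos_less_mono[OF greater] by simp
    then show ?thesis
      using orth_proj_entry_sym[OF P(1), of j k] orth_proj_entry_sym[OF H(1), of j k] by simp
  qed (use diag upper j in auto)
qed

lemma grassmannian_eq_if_measurements_agree:
  fixes P H :: "real^('n::{finite,linorder})^('n::{finite,linorder})"
  assumes PG: "P \<in> grassmannian d" and HG: "H \<in> grassmannian d" and "d \<le> CARD('n)"
    and inj: "inj_on ((*v) P) (coord_subspace {i. idx_pos i \<le> d})"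
    and diag_meas: "\<forall>i. idx_pos i \<le> CARD('n) - 1 \<longrightarrow>
      norm (H *v unit_vec i)^2 = norm (P *v unit_vec i)^2"
    and pair_meas: "\<forall>j k. idx_pos j \<le> d \<and> j < k \<longrightarrow>
      norm (H *v (unit_vec j + unit_vec k))^2 = norm (P *v (unit_vec j + unit_vec k))^2"
  shows "H = P"
proof -
  have P: "orth_proj P" "rank P = d" and H: "orth_proj H" "rank H = d"
    using PG HG by (auto simp: grassmannian_iff)
  have first_rows: "H$j$k = P$j$k" if "idx_pos j \<le> d" for j k
    using first_rows_eq_if_measurements_agree[OF PG HG diag_meas pair_meas that] .
  show ?thesis
  proof (rule orth_proj_eq_if_agree_on_subspace[OF P(1) H(1)])
    show "dim (coord_subspace {i::'n. idx_pos i \<le> d}) = rank P"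
      using card_idx_pos_le[OF assms(3)] P(2) by (simp add: dim_coord_subspace)
    show "H *v v = P *v v" if "v \<in> coord_subspace {i. idx_pos i \<le> d}" for v
      using that
    proof (rule matrix_vector_mult_eq_on_coord_subspace[rotated])
      show "H$a$b = P$a$b" if "b \<in> {i. idx_pos i \<le> d}" for a b
        using that first_rows[of b a] orth_proj_entry_sym[OF P(1)] orth_proj_entry_sym[OF H(1)]
        by simp
    qed
  qed (use inj P H subspace_coord_subspace in auto)
qed

subsection \<open>Householder reflections\<close>

definition householder :: "real^'n \<Rightarrow> real^'n^'n" where
  "householder w = mat 1 - (2 / (w \<bullet> w)) *\<^sub>R (\<chi> a b. w$a * w$b)"

lemma householder_apply: "householder w *v x = x - ((2 / (w \<bullet> w)) * (w \<bullet> x)) *\<^sub>R w"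
proof -
  have "(\<chi> a b. w$a * w$b) *v x = (w \<bullet> x) *\<^sub>R w"
    by (simp add: vec_eq_iff matrix_vector_mult_def inner_vec_def sum_distrib_left mult_ac)
  then show ?thesis
    by (simp add: householder_def matrix_vector_mult_diff_rdistrib scaleR_matrix_vector_assoc[symmetric])
qed

lemma transpose_householder: "transpose (householder w) = householder w"
  by (simp add: householder_def vec_eq_iff transpose_def mat_def mult.commute)

lemma householder_fix: "w \<bullet> x = 0 \<Longrightarrow> householder w *v x = x"
  by (simp add: householder_apply)

lemma householder_involutive_apply: "householder w *v (householder w *v x) = x"
proof (cases "w \<bullet> w = 0")
  case False
  have "w \<bullet> (householder w *v x) = - (w \<bullet> x)"
    using False by (simp add: householder_apply inner_diff_right algebra_simps)
  then show ?thesis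
    by (subst (1) householder_apply) (simp add: householder_apply algebra_simps)
qed (simp add: householder_apply)

lemma orthogonal_matrix_householder: "orthogonal_matrix (householder w)"
  by (simp add: orthogonal_matrix_def transpose_householder matrix_eq
      matrix_vector_mul_assoc[symmetric] householder_involutive_apply)

lemma householder_swap:
  fixes a e :: "real^'n"
  assumes a: "norm a = 1" and e: "norm e = 1"
  shows "householder (a - e) *v e = a"
proof (cases "a = e")
  case False
  have aa: "a \<bullet> a = 1" and ee: "e \<bullet> e = 1"
    using a e by (simp_all add: norm_eq_1)
  have "(a - e) \<bullet> (a - e) = 2 - 2 * (a \<bullet> e)"
    using aa ee by (simp add: inner_diff_left inner_diff_right inner_commute)
  moreover have "(a - e) \<bullet> (a - e) \<noteq> 0"
    using False by simp
  moreover have "(a - e) \<bullet> e = a \<bullet> e - 1"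
    using ee by (simp add: inner_diff_left)
  ultimately have "(2 / ((a - e) \<bullet> (a - e))) * ((a - e) \<bullet> e) = -1"
    by (simp add: field_simps)
  then show ?thesis
    by (simp add: householder_apply)
qed (simp add: householder_apply)

subsection \<open>The exceptional sets\<close>

definition kernel_onset ::
  "'n::{finite,linorder} \<Rightarrow> (real^('n::{finite,linorder})^('n::{finite,linorder})) set" where
  "kernel_onset j = {X. orth_proj X \<and> inj_on ((*v) X) (coord_subspace {i. i < j}) \<and>
     \<not> inj_on ((*v) X) (coord_subspace {i. i \<le> j})}"

lemma not_inj_on_imp_kernel_onset:
  fixes X :: "real^('n::{finite,linorder})^('n::{finite,linorder})"
  assumes "orth_proj X" and "\<not> inj_on ((*v) X) (coord_subspace {i. idx_pos i \<le> d})"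
  obtains j where "idx_pos j \<le> d" "X \<in> kernel_onset j"
proof -
  define J where "J = {k. \<not> inj_on ((*v) X) (coord_subspace {i. i \<le> k})}"
  obtain k where k: "idx_pos k \<le> d" "k \<in> J"
    using not_inj_on_coord_subspace_initial[OF assms(2)] by (auto simp: J_def)
  define j where "j = Min J"
  have "j \<in> J" and "j \<le> k"
    using k by (auto simp: j_def intro: Min_in Min_le)
  moreover have "inj_on ((*v) X) (coord_subspace {i. i < j})"
  proof (rule ccontr)
    assume "\<not> inj_on ((*v) X) (coord_subspace {i. i < j})"
    then obtain k' where "k' < j" "k' \<in> J"
      by (rule not_inj_on_coord_subspace_initial) (auto simp: J_def)
    then show False
      by (metis Min_le finite leD j_def)
  qed
  ultimately show ?thesis
    using assms(1) k(1) idx_pos_le_mono[of j k]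
    by (intro that[of j]) (auto simp: J_def kernel_onset_def)
qed

lemma borel_measurable_matrix_entry: "(\<lambda>X::real^'n^'m. X$a$b) \<in> borel_measurable borel"
  by (intro borel_measurable_continuous_onI continuous_intros)

definition principal_block :: "'n set \<Rightarrow> real^'n^'n \<Rightarrow> real^'n^'n" where
  "principal_block I X = (\<chi> a b. if a \<in> I \<and> b \<in> I then X$a$b else if a = b then 1 else 0)"

lemma principal_block_apply_outside:
  assumes "a \<notin> I"
  shows "(principal_block I X *v c)$a = c$a"
proof -
  have "(principal_block I X)$a$b * c$b = (if b = a then c$b else 0)" for b
    using assms by (simp add: principal_block_def)
  then have "(principal_block I X *v c)$a = (\<Sum>b\<in>UNIV. if b = a then c$b else 0)"
    by (simp add: matrix_vector_mult_def)
  then show ?thesis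
    by simp
qed

lemma principal_block_apply_inside:
  assumes "a \<in> I" and "c \<in> coord_subspace I"
  shows "(principal_block I X *v c)$a = (X *v c)$a"
proof -
  have "(principal_block I X)$a$b * c$b = X$a$b * c$b" for b
    using assms by (auto simp: principal_block_def coord_subspace_def)
  then show ?thesis
    by (simp only: matrix_vector_mult_def vec_lambda_beta)
qed

lemma principal_block_kernel:
  assumes "orth_proj X"
  shows "principal_block I X *v c = 0 \<longleftrightarrow> c \<in> coord_subspace I \<and> X *v c = 0"
proof
  assume block: "principal_block I X *v c = 0"
  have "c$a = 0" if "a \<notin> I" for a
    using block principal_block_apply_outside[OF that, of X c] by simp
  then have c: "c \<in> coord_subspace I"
    by (simp add: coord_subspace_def)
  have "(X *v c)$a = 0" if "a \<in> I" for a
    using block principal_block_apply_inside[OF that c, of X] by simp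
  then have "c \<bullet> (X *v c) = 0"
    using c by (intro inner_eq_0_if_disjoint_support) (auto simp: coord_subspace_def)
  then show "c \<in> coord_subspace I \<and> X *v c = 0"
    using c norm_orth_proj_apply_sq[OF assms, of c] by simp
next
  assume c: "c \<in> coord_subspace I \<and> X *v c = 0"
  show "principal_block I X *v c = 0"
  proof (subst vec_eq_iff, intro allI)
    fix a
    show "(principal_block I X *v c)$a = 0$a"
      using c principal_block_apply_inside[of a I c X] principal_block_apply_outside[of a I X c]
      by (cases "a \<in> I") (auto simp: coord_subspace_def)
  qed
qed

lemma det_principal_block_eq_0_iff:
  assumes "orth_proj X"
  shows "det (principal_block I X) = 0 \<longleftrightarrow> \<not> inj_on ((*v) X) (coord_subspace I)"
proof -
  have "det (principal_block I X) \<noteq> 0 \<longleftrightarrow> inj ((*v) (principal_block I X))"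
    using det_nz_iff_inj[of "(*v) (principal_block I X)"] by simp
  also have "\<dots> \<longleftrightarrow> (\<forall>c. principal_block I X *v c = 0 \<longrightarrow> c = 0)"
    using linear_inj_iff_eq_0[of "(*v) (principal_block I X)"] by simp
  finally show ?thesis
    using principal_block_kernel[OF assms] not_inj_on_coord_subspace_iff by blast
qed

lemma borel_measurable_det_principal_block:
  "(\<lambda>X::real^'n^'n. det (principal_block I X)) \<in> borel_measurable borel"
proof -
  have "det (principal_block I X) = (\<Sum>p\<in>{p. p permutes UNIV}. of_int (sign p) *
      (\<Prod>i\<in>UNIV. if i \<in> I \<and> p i \<in> I then X$i$p i else if i = p i then 1 else 0))" for X
    by (simp add: det_def principal_block_def)
  then show ?thesis
    by (simp only:)
      (measurable; (rule borel_measurable_matrix_entry measurable_const sets.sets_Collect_const)?; simp)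
qed

lemma sets_kernel_onset: "kernel_onset j \<in> sets borel"
proof -
  have "kernel_onset j = {X \<in> space borel. (\<forall>a b. X$b$a = X$a$b) \<and>
      (\<forall>a b. (\<Sum>k\<in>UNIV. X$a$k * X$k$b) = X$a$b) \<and>
      det (principal_block {i. i < j} X) \<noteq> 0 \<and> det (principal_block {i. i \<le> j} X) = 0}"
    by (auto simp: kernel_onset_def det_principal_block_eq_0_iff orth_proj_def vec_eq_iff
        transpose_def matrix_matrix_mult_def)
  also have "\<dots> \<in> sets borel"
    using borel_measurable_det_principal_block[of "{i. i < j}"]
      borel_measurable_det_principal_block[of "{i. i \<le> j}"] borel_measurable_matrix_entry
    by measurable
  finally show ?thesis .
qed

text \<open>A kernel vector c of the conjugate has c_j \<noteq> 0 by minimality of j. The reflection R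
  fixes the part c' of c below j and sends e_j to a, so 0 = u \<bullet> R c = c_j (u \<bullet> a).\<close>

lemma kernel_onset_reflection_orthogonal:
  fixes P :: "real^('n::{finite,linorder})^('n::{finite,linorder})"
  assumes P: "orth_proj P" and u: "P *v u = u" "u \<in> coord_subspace {i. j \<le> i}"
    and a: "norm a = 1" "a \<in> coord_subspace {i. j \<le> i}"
    and conj: "householder (a - axis j 1) ** P ** transpose (householder (a - axis j 1))
      \<in> kernel_onset j"
  shows "u \<bullet> a = 0"
proof -
  define R where "R = householder (a - axis j 1)"
  obtain c where c: "c \<in> coord_subspace {i. i \<le> j}" "c \<noteq> 0" "(R ** P ** R) *v c = 0"
    using conj not_inj_on_coord_subspace_iff
    unfolding kernel_onset_def R_def transpose_householder by blast
  have cj: "c$j \<noteq> 0"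
  proof
    assume "c$j = 0"
    then have "c \<in> coord_subspace {i. i < j}"
      using c(1) by (auto simp: coord_subspace_def) (metis le_less)
    then show False
      using c conj not_inj_on_coord_subspace_iff
      unfolding kernel_onset_def R_def transpose_householder by blast
  qed
  have "R *v (P *v (R *v c)) = 0"
    using c(3) by (metis matrix_vector_mul_assoc matrix_mul_assoc)
  then have PRc: "P *v (R *v c) = 0"
    using householder_involutive_apply[of "a - axis j 1" "P *v (R *v c)"] by (simp add: R_def)
  define c' where "c' = c - c$j *\<^sub>R axis j 1"
  have c'_below: "c'$i = 0" if "\<not> i < j" for i
    using c(1) that by (auto simp: c'_def axis_def coord_subspace_def)
  have "(a - axis j 1) \<bullet> c' = 0"
    using a(2) c'_below
    by (intro inner_eq_0_if_disjoint_support) (auto simp: axis_def coord_subspace_def not_le)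
  moreover have "c = c' + c$j *\<^sub>R axis j 1"
    by (simp add: c'_def)
  ultimately have "R *v c = c' + c$j *\<^sub>R a"
    using householder_swap[OF a(1) norm_axis_1]
    by (metis R_def householder_fix matrix_vector_right_distrib matrix_vector_mult_scaleR)
  moreover have "u \<bullet> c' = 0"
    using u(2) c'_below by (intro inner_eq_0_if_disjoint_support) (auto simp: coord_subspace_def not_le)
  moreover have "u \<bullet> (R *v c) = 0"
    using orth_proj_inner_commute[OF P, of u "R *v c"] u(1) PRc by simp
  ultimately show ?thesis
    using cj by (simp add: inner_add_right)
qed

subsection \<open>The moment curve\<close>

definition moment_curve :: "real \<Rightarrow> real^('n::{finite,linorder})" where
  "moment_curve s = (\<chi> i. s ^ idx_pos i)"

lemma moment_curve_orthogonal_roots: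
  fixes u :: "real^('n::{finite,linorder})"
  assumes "u \<noteq> 0"
  shows "finite {s. u \<bullet> moment_curve s = 0} \<and> card {s. u \<bullet> moment_curve s = 0} \<le> CARD('n)"
proof -
  define p where "p = (\<Sum>i\<in>UNIV. monom (u$i) (idx_pos i))"
  have eval: "u \<bullet> moment_curve s = poly p s" for s
    by (simp add: p_def poly_sum poly_monom inner_vec_def moment_curve_def)
  obtain i0 where i0: "u$i0 \<noteq> 0"
    using assms by (auto simp: vec_eq_iff)
  have "coeff p (idx_pos i0) = (\<Sum>i\<in>UNIV. if i = i0 then u$i else 0)"
    unfolding p_def coeff_sum coeff_monom by (intro sum.cong) (auto simp: inj_eq[OF inj_idx_pos])
  also have "\<dots> = u$i0"
    by simp
  finally have "coeff p (idx_pos i0) = u$i0" .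
  then have "p \<noteq> 0"
    using i0 by auto
  moreover have "degree p \<le> CARD('n)"
    unfolding p_def by (intro degree_sum_le) (auto intro: order.trans[OF degree_monom_le] idx_pos_le_card)
  ultimately show ?thesis
    using poly_roots_finite[of p] card_poly_roots_bound[of p] by (simp add: eval)
qed

definition moment_direction :: "'n::{finite,linorder} \<Rightarrow> nat \<Rightarrow> real^('n::{finite,linorder})" where
  "moment_direction j t = sgn (coord_restrict {i. j \<le> i} (moment_curve (real (Suc t))))"

definition moment_reflection ::
  "'n::{finite,linorder} \<Rightarrow> nat \<Rightarrow> real^('n::{finite,linorder})^('n::{finite,linorder})" where
  "moment_reflection j t = householder (moment_direction j t - axis j 1)"

lemma moment_direction_nonzero_part:
  "coord_restrict {i. j \<le> i} (moment_curve (real (Suc t))) \<noteq> (0 :: real^'n::{finite,linorder})"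
proof -
  have "coord_restrict {i. j \<le> i} (moment_curve (real (Suc t))) $ j \<noteq> (0 :: real)"
    by (simp add: coord_restrict_def moment_curve_def)
  then show ?thesis
    by auto
qed

lemma norm_moment_direction: "norm (moment_direction j t) = 1"
  using moment_direction_nonzero_part by (simp add: moment_direction_def norm_sgn)

lemma moment_direction_in_coord_subspace: "moment_direction j t \<in> coord_subspace {i. j \<le> i}"
  unfolding moment_direction_def sgn_div_norm
  by (intro subspace_scale subspace_coord_subspace coord_restrict_in_coord_subspace)

lemma inner_moment_direction_eq_0:
  assumes "u \<in> coord_subspace {i. j \<le> i}" and "u \<bullet> moment_direction j t = 0"
  shows "u \<bullet> moment_curve (real (Suc t)) = 0"
  using assms moment_direction_nonzero_part[of j t]
  by (simp add: moment_direction_def sgn_div_norm inner_coord_restrict)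

lemma finite_moment_reflection_hits:
  fixes P :: "real^('n::{finite,linorder})^('n::{finite,linorder})"
  assumes PG: "P \<in> grassmannian d" and j: "idx_pos j \<le> d"
  defines "T \<equiv> {t. moment_reflection j t ** P ** transpose (moment_reflection j t) \<in> kernel_onset j}"
  shows "finite T \<and> card T \<le> CARD('n)"
proof -
  have P: "orth_proj P" "rank P = d"
    using PG by (auto simp: grassmannian_iff)
  have "card (- {i. j \<le> i}) < dim (range ((*v) P))"
    using j P(2) by (simp add: idx_pos_def rank_dim_range Compl_eq not_le)
  moreover have "subspace (range ((*v) P))"
    by (simp add: linear_subspace_image)
  ultimately obtain u where u: "u \<in> range ((*v) P)" "u \<noteq> 0" "u \<in> coord_subspace {i. j \<le> i}"
    using exists_nonzero_vanishing_on[of _ "- {i. j \<le> i}"] by (metis double_compl)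
  have "P *v u = u"
    using u(1) orth_proj_idem_apply[OF P(1)] by auto
  then have hits: "u \<bullet> moment_curve (real (Suc t)) = 0" if "t \<in> T" for t
    using kernel_onset_reflection_orthogonal[OF P(1) _ u(3) norm_moment_direction
        moment_direction_in_coord_subspace] that u(3)
    by (intro inner_moment_direction_eq_0) (auto simp: T_def moment_reflection_def)
  define roots where "roots = {s. u \<bullet> moment_curve s = 0}"
  have T_roots: "T \<subseteq> (\<lambda>t. real (Suc t)) -` roots"
    using hits by (auto simp: roots_def)
  have inj: "inj (\<lambda>t. real (Suc t))"
    by (simp add: inj_on_def)
  have roots: "finite roots" "card roots \<le> CARD('n)"
    using moment_curve_orthogonal_roots[OF u(2)] by (simp_all add: roots_def)
  have fin: "finite ((\<lambda>t. real (Suc t)) -` roots)"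
    using finite_vimageI[OF roots(1) inj] .
  have "card T \<le> card ((\<lambda>t. real (Suc t)) -` roots)"
    using card_mono[OF fin T_roots] .
  also have "\<dots> \<le> card roots"
    using card_vimage_inj_on_le[OF inj roots(1)] by simp
  finally show ?thesis
    using roots(2) finite_subset[OF T_roots fin] by simp
qed

subsection \<open>The exceptional sets are null\<close>

lemma (in prob_space) prob_eq_0_if_bounded_overlap:
  fixes A :: "nat \<Rightarrow> 'a set"
  assumes events: "\<And>t. A t \<in> events" and prob: "\<And>t. prob (A t) = p"
    and overlap: "AE x in M. finite {t. x \<in> A t} \<and> card {t. x \<in> A t} \<le> n"
  shows "p = 0"
proof -
  have integrable: "integrable M (indicator (A t) :: 'a \<Rightarrow> real)" for t
    using events by (simp add: emeasure_space_1 emeasure_finite less_top[symmetric])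
  have bound: "real K * p \<le> real n" for K
  proof -
    have "real K * p = (\<Sum>t<K. integral\<^sup>L M (indicator (A t)))"
      using events prob by simp
    also have "\<dots> = integral\<^sup>L M (\<lambda>x. \<Sum>t<K. indicator (A t) x)"
      by (rule Bochner_Integration.integral_sum[symmetric]) (rule integrable)
    also have "\<dots> \<le> integral\<^sup>L M (\<lambda>x. real n)"
    proof (rule integral_mono_AE)
      show "AE x in M. (\<Sum>t<K. indicator (A t) x) \<le> real n"
        using overlap
      proof eventually_elim
        case (elim x)
        have "(\<Sum>t<K. indicator (A t) x :: real) = real (card {t. t < K \<and> x \<in> A t})"
          by (simp add: indicator_def sum.If_cases Int_def conj_commute)
        also have "\<dots> \<le> real (card {t. x \<in> A t})"
          using elim by (intro of_nat_mono card_mono) auto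
        also have "\<dots> \<le> real n"
          using elim by simp
        finally show ?case .
      qed
    qed (use integrable in auto)
    finally show ?thesis
      by (simp add: prob_space)
  qed
  show ?thesis
  proof (rule ccontr)
    assume "p \<noteq> 0"
    then have "p > 0"
      using prob[of 0] measure_nonneg[of M "A 0"] by linarith
    then obtain K where "real n < real K * p"
      using ex_less_of_nat_mult by blast
    then show False
      using bound[of K] by simp
  qed
qed

lemma AE_grassmannian:
  assumes "haar_grassmannian d M"
  shows "AE P in M. P \<in> grassmannian d"
proof -
  interpret prob_space M
    using assms by (simp add: haar_grassmannian_def)
  have "grassmannian d \<in> sets M"
    using assms emeasure_notin_sets by (fastforce simp: haar_grassmannian_def)
  then show ?thesis
    using assms by (subst AE_in_set_eq_1) (auto simp: haar_grassmannian_def emeasure_eq_measure)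
qed

lemma kernel_onset_null:
  fixes M :: "(real^('n::{finite,linorder})^('n::{finite,linorder})) measure"
  assumes haar: "haar_grassmannian d M" and j: "idx_pos j \<le> d"
  shows "kernel_onset j \<in> null_sets M"
proof -
  have sets_M: "sets M = sets borel" and "prob_space M"
    and invariant: "\<And>Q. orthogonal_matrix Q \<Longrightarrow> distr M M (\<lambda>P. Q ** P ** transpose Q) = M"
    using haar by (auto simp: haar_grassmannian_def)
  interpret prob_space M by fact
  have space_M: "space M = UNIV"
    using sets_eq_imp_space_eq[OF sets_M] by simp
  define conj where "conj t P = moment_reflection j t ** P ** transpose (moment_reflection j t)"
    for t P
  have conj_measurable: "conj t \<in> measurable M M" for t
    unfolding conj_def measurable_cong_sets[OF sets_M sets_M]
    by (intro borel_measurable_continuous_onI)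
      (simp add: matrix_matrix_mult_def transpose_def; intro continuous_intros)
  have kernel_onset_M: "kernel_onset j \<in> sets M"
    using sets_kernel_onset sets_M by simp
  have events: "conj t -` kernel_onset j \<in> events" for t
    using measurable_sets[OF conj_measurable kernel_onset_M] by (simp add: space_M)
  have prob_conj: "prob (conj t -` kernel_onset j) = prob (kernel_onset j)" for t
  proof -
    have "distr M M (conj t) = M"
      unfolding conj_def moment_reflection_def by (rule invariant[OF orthogonal_matrix_householder])
    then show ?thesis
      using measure_distr[OF conj_measurable kernel_onset_M, of t] by (simp add: space_M)
  qed
  have "AE P in M. finite {t. P \<in> conj t -` kernel_onset j} \<and>
      card {t. P \<in> conj t -` kernel_onset j} \<le> CARD('n)"
    using AE_grassmannian[OF haar]
    by eventually_elim (use finite_moment_reflection_hits[OF _ j] in \<open>simp add: conj_def\<close>)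
  then have "prob (kernel_onset j) = 0"
    by (rule prob_eq_0_if_bounded_overlap[OF events prob_conj])
  then show ?thesis
    using kernel_onset_M by (simp add: emeasure_eq_measure null_sets_def)
qed

lemma AE_inj_on_first_coords:
  fixes M :: "(real^('n::{finite,linorder})^('n::{finite,linorder})) measure"
  assumes "haar_grassmannian d M"
  shows "AE P in M. P \<in> grassmannian d \<and> inj_on ((*v) P) (coord_subspace {i. idx_pos i \<le> d})"
proof -
  have "AE P in M. P \<notin> kernel_onset j" if "idx_pos j \<le> d" for j
    using kernel_onset_null[OF assms that] by (rule AE_not_in)
  then have "AE P in M. \<forall>j\<in>{j. idx_pos j \<le> d}. P \<notin> kernel_onset j"
    by (subst AE_finite_all) auto
  with AE_grassmannian[OF assms] show ?thesis
    by eventually_elim (metis grassmannian_iff mem_Collect_eq not_inj_on_imp_kernel_onset)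
qed

lemma (in sigma_finite_measure) AE_pair_fst:
  assumes "AE x in N. Q x"
  shows "AE z in N \<Otimes>\<^sub>M M. Q (fst z)"
proof -
  obtain S where S: "{x \<in> space N. \<not> Q x} \<subseteq> S" "emeasure N S = 0" "S \<in> sets N"
    using assms by (rule AE_E)
  then have "S \<times> space M \<in> null_sets (N \<Otimes>\<^sub>M M)"
    by (intro times_in_null_sets1) auto
  then show ?thesis
    by (rule AE_I') (use S(1) in \<open>auto simp: space_pair_measure\<close>)
qed

theorem theorem4p5:
  fixes d :: nat
    and M :: "(real^('n::{finite,linorder})^('n::{finite,linorder})) measure"
    and \<mu> :: "(real^('n::{finite,linorder})) measure"
  assumes "1 \<le> d" and "d < CARD('n)"
    and "haar_grassmannian d M"
    and "sets \<mu> = sets borel" and "prob_space \<mu>"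
    and "absolutely_continuous lborel \<mu>"
  shows "AE Px in M \<Otimes>\<^sub>M \<mu>. determined_by_measurements d (fst Px) (snd Px)"
proof -
  interpret \<mu>: prob_space \<mu>
    by fact
  have "AE Px in M \<Otimes>\<^sub>M \<mu>. fst Px \<in> grassmannian d \<and>
      inj_on ((*v) (fst Px)) (coord_subspace {i. idx_pos i \<le> d})"
    by (rule \<mu>.AE_pair_fst[OF AE_inj_on_first_coords[OF assms(3)]])
  then show ?thesis
    by eventually_elim
      (use assms(2) in \<open>auto simp: determined_by_measurements_def
        intro: grassmannian_eq_if_measurements_agree\<close>)
qed

end
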